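(* Let $c_k:\mathbb{Z}\to\mathbb{C}$ ($k=2,3$) be arbitrary functions and $b$ a constant. Let $\phi_i=\phi_{i,l_2,l_3}^{m,s}$ ($i=1,2,3,\dots$) be functions of $(l_2,l_3,m,s)\in\mathbb{Z}^4$ (independent of $l_1$) satisfying the linear relations $$\frac{\phi_{i,l_k+1}-\phi_i}{c_k(l_k)}=-\phi_i^{s+1}\quad(k=2,3),\qquad \frac{\phi_i-\phi_i^{m-1}}{b}=-\phi_i^{s-1}.$$ Let $\kappa=\kappa_{l_1,l_2,l_3}^{m,s}$ be the $l_1\times l_1$ Casorati determinant $\kappa=\det\left(\phi_i^{s+j-1}\right)_{i,j=1,\dots,l_1}$. Then $$\tau=\left[\prod_{k=2}^3\ \prod_{j_k}^{l_k-1}(1+c_k(j_k)b)^{-m}\,c_k(j_k)^{-s}\right]b^{-ms}\,\kappa$$ satisfies the bilinear equations $$\tau^{m+1}\,\tau_{l_i+1}-\tau\,\tau_{l_i+1}^{m+1}=\tau^{s+1}\,\tau_{l_i+1}^{m+1,s-1}\qquad(i=1,2,3).$$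
   Context: Notation: only shifted independent variables are displayed. E.g. $\tau=\tau_{l_1,l_2,l_3}^{m,s}$, $\tau_{l_i+1}^{m+1,s-1}$ is $\tau$ with $l_i,m$ raised by one and $s$ lowered by one, $\phi_i^{s+j-1}$ is $\phi_i$ with $s$ replaced by $s+j-1$, $\phi_{i,l_k+1}$ is $\phi_i$ with $l_k$ raised by one. Here $l_1$ is a nonnegative integer (the size of the determinant; a $0\times0$ determinant equals $1$) and the remaining variables are integers. The symbol $\prod_{j}^{l-1}g(j)$ denotes an indefinite product with an arbitrary fixed lower limit, i.e. a function $G(l)$ with $G(l+1)=g(l)G(l)$; $\prod_j^{l-1}(1+c(j)b)^{-m} c(j)^{-s}$ means the $(-m)$-th power of the indefinite product of $1+c(j)b$ times the $(-s)$-th power of that of $c(j)$. The quantities $b$, $c_k(l)$, $1+c_k(l)b$ are understood to be nonzero so that all expressions are defined. *)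

theory Defs
  imports Complex_Main "Jordan_Normal_Form.Determinant"
begin

text \<open>
  An indefinite product of \<open>g\<close> is a solution \<open>G\<close> of the recurrence
  \<open>G (l + 1) = g l * G l\<close>, determined up to a constant factor (the choice of the lower limit).
  The zero solution is not such a product and is excluded.
\<close>

definition indefinite_product :: "(int \<Rightarrow> complex) \<Rightarrow> (int \<Rightarrow> complex) \<Rightarrow> bool" where
  "indefinite_product g G \<longleftrightarrow> (\<forall>l. G l \<noteq> 0 \<and> G (l + 1) = g l * G l)"

lemma indefinite_product_lower_limit:
  fixes a :: int
  assumes "\<And>l. g l \<noteq> 0"
  shows "indefinite_product g (\<lambda>l. (\<Prod>j\<in>{a..<l}. g j) / (\<Prod>j\<in>{l..<a}. g j))"
  unfolding indefinite_product_def
proof (intro allI conjI)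
  fix l :: int
  show "(\<Prod>j\<in>{a..<l}. g j) / (\<Prod>j\<in>{l..<a}. g j) \<noteq> 0"
    using assms by simp
  show "(\<Prod>j\<in>{a..<l+1}. g j) / (\<Prod>j\<in>{l+1..<a}. g j)
      = g l * ((\<Prod>j\<in>{a..<l}. g j) / (\<Prod>j\<in>{l..<a}. g j))"
  proof (cases "a \<le> l")
    case True
    then have "{a..<l+1} = insert l {a..<l}" by auto
    with True show ?thesis by simp
  next
    case False
    then have "{l..<a} = insert l {l+1..<a}" by auto
    with False assms show ?thesis by simp
  qed
qed

text \<open>
  Throughout, \<open>\<phi> i l2 l3 m s\<close> is the function \<open>\<phi>\<^sub>i\<close> (\<open>i \<ge> 1\<close>) at \<open>(l2, l3, m, s)\<close>.
  Matrix indices start at \<open>0\<close>, so the entry at \<open>(i, j)\<close> is the one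
  in row \<open>i + 1\<close> and column \<open>j + 1\<close> in one-based numbering.
\<close>

definition casorati ::
  "(nat \<Rightarrow> int \<Rightarrow> int \<Rightarrow> int \<Rightarrow> int \<Rightarrow> complex) \<Rightarrow> nat \<Rightarrow> int \<Rightarrow> int \<Rightarrow> int \<Rightarrow> int \<Rightarrow> complex" where
  "casorati \<phi> l1 l2 l3 m s = det (mat l1 l1 (\<lambda>(i, j). \<phi> (i + 1) l2 l3 m (s + int j)))"

text \<open>
  In \<open>tau\<close>, \<open>P2\<close>, \<open>P3\<close> are the indefinite products of \<open>1 + c2 j * b\<close>, \<open>1 + c3 j * b\<close>,
  and \<open>Q2\<close>, \<open>Q3\<close> those of \<open>c2 j\<close>, \<open>c3 j\<close>.
\<close>

definition tau ::
  "(int \<Rightarrow> complex) \<Rightarrow> (int \<Rightarrow> complex) \<Rightarrow> (int \<Rightarrow> complex) \<Rightarrow> (int \<Rightarrow> complex) \<Rightarrow> complex \<Rightarrow>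
   (nat \<Rightarrow> int \<Rightarrow> int \<Rightarrow> int \<Rightarrow> int \<Rightarrow> complex) \<Rightarrow> nat \<Rightarrow> int \<Rightarrow> int \<Rightarrow> int \<Rightarrow> int \<Rightarrow> complex" where
  "tau P2 Q2 P3 Q3 b \<phi> l1 l2 l3 m s =
     (P2 l2 powi (- m) * Q2 l2 powi (- s)) * (P3 l3 powi (- m) * Q3 l3 powi (- s))
     * b powi (- (m * s)) * casorati \<phi> l1 l2 l3 m s"

end

theory Submission
  imports Defs
begin

text \<open>
  Put \<open>L i k = \<phi>\<^bsub>i+1\<^esub>\<close> at \<open>(m + 1, s - 1 + k)\<close> and read row \<open>i\<close> as the linear functional
  \<open>x\<^sup>k \<mapsto> L i k\<close> on polynomials of degree at most \<open>N + 1\<close>. By the linear relations, lowering \<open>m\<close>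
  multiplies the argument polynomial by \<open>(x + b) / x\<close>, raising \<open>s\<close> by \<open>x\<close>, and raising \<open>l\<^sub>k\<close>
  by \<open>1 - c\<^sub>k x\<close>. Hence every \<open>N \<times> N\<close> Casorati determinant in the bilinear equations is the
  determinant of the \<open>N\<close> functionals on the polynomials vanishing at two of the points \<open>0\<close>,
  \<open>- b\<close>, \<open>\<infinity>\<close>, \<open>1 / c\<^sub>k\<close>; up to a factor this is the determinant of order \<open>N + 2\<close> bordered by
  the two evaluations. The bilinear equation is the three-term Pluecker relation between these
  bordered determinants. For the shift of \<open>l\<^sub>1\<close> the evaluation at \<open>1 / c\<^sub>k\<close> is replaced by
  the functional \<open>L N\<close>.
\<close>

section \<open>Determinants as functions of their rows\<close>

text \<open>With the rows given as a function, replacing a row is a function update and prepending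
  one is \<open>case_nat\<close>.\<close>

definition row_det :: "nat \<Rightarrow> (nat \<Rightarrow> nat \<Rightarrow> 'a :: comm_ring_1) \<Rightarrow> 'a" where
  "row_det n F = det (mat n n (\<lambda>(i, j). F i j))"

lemma row_det_cong:
  assumes "\<And>i k. i < n \<Longrightarrow> k < n \<Longrightarrow> F i k = F' i k"
  shows "row_det n F = row_det n F'"
proof -
  have "mat n n (\<lambda>(i, j). F i j) = mat n n (\<lambda>(i, j). F' i j)"
    using assms by (intro eq_matI) auto
  then show ?thesis by (simp add: row_det_def)
qed

lemma row_det_identical_rows:
  assumes "i \<noteq> j" "i < n" "j < n" "F i = F j"
  shows "row_det n F = 0"
  unfolding row_det_def
  by (rule det_identical_rows[of _ n i j]) (use assms in auto)

text \<open>Cofactors along row \<open>i\<close> delete that row, so those of \<open>F\<close> serve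
  for every \<open>f\<close>; this gives linearity in the replaced row.\<close>

lemma row_det_expand_row:
  assumes i: "i < n"
  shows "row_det n (F(i := f)) = (\<Sum>k<n. f k * cofactor (mat n n (\<lambda>(i, j). F i j)) i k)"
proof -
  let ?M = "\<lambda>F. mat n n (\<lambda>(i, j). F i j)"
  let ?F = "F(i := f)"
  have "row_det n ?F = (\<Sum>k<n. ?M ?F $$ (i, k) * cofactor (?M ?F) i k)"
    unfolding row_det_def by (rule laplace_expansion_row) (use i in auto)
  also have "\<dots> = (\<Sum>k<n. f k * cofactor (?M F) i k)"
  proof (rule sum.cong[OF refl])
    fix k assume k: "k \<in> {..<n}"
    have "mat_delete (?M ?F) i k = mat_delete (?M F) i k"
      unfolding mat_delete_def by (intro eq_matI) (use i k in auto)
    then show "?M ?F $$ (i, k) * cofactor (?M ?F) i k = f k * cofactor (?M F) i k"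
      using i k by (simp add: cofactor_def)
  qed
  finally show ?thesis .
qed

lemma row_det_scale_row:
  "i < n \<Longrightarrow> row_det n (F(i := (\<lambda>k. a * f k))) = a * row_det n (F(i := f))"
  by (simp add: row_det_expand_row sum_distrib_left mult.assoc)

text \<open>The adjugate times the matrix is the determinant times the identity. Contracting this
  with \<open>f\<close> turns the cofactor sums into Laplace expansions along the replaced
  rows.\<close>

lemma row_det_cramer:
  assumes k: "k < n"
  shows "row_det n F * f k = (\<Sum>i<n. row_det n (F(i := f)) * F i k)"
proof -
  define M where "M = mat n n (\<lambda>(i, j). F i j)"
  have M: "M \<in> carrier_mat n n" by (simp add: M_def)
  have adj: "(\<Sum>i<n. cofactor M i j * F i k) = (if j = k then det M else 0)" if j: "j < n" for j
  proof -
    have "(adj_mat M * M) $$ (j, k) = (\<Sum>i<n. cofactor M i j * F i k)"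
      using j k adj_mat(1)[OF M]
      by (auto simp: adj_mat_def scalar_prod_def M_def lessThan_atLeast0)
    then show ?thesis using adj_mat(3)[OF M] j k by (cases "j = k") auto
  qed
  have "(\<Sum>i<n. row_det n (F(i := f)) * F i k)
      = (\<Sum>i<n. \<Sum>j<n. f j * (cofactor M i j * F i k))"
    by (simp add: row_det_expand_row M_def sum_distrib_right mult.assoc)
  also have "\<dots> = (\<Sum>j<n. f j * (\<Sum>i<n. cofactor M i j * F i k))"
    by (subst sum.swap) (simp add: sum_distrib_left)
  also have "\<dots> = (\<Sum>j<n. if j = k then f j * det M else 0)"
    by (rule sum.cong) (auto simp: adj)
  also have "\<dots> = f k * det M" using k by simp
  finally show ?thesis by (simp add: row_det_def M_def mult.commute)
qed

section \<open>Bordered determinants and the three-term Pluecker relation\<close>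

text \<open>The order is \<open>n + 2\<close>: \<open>f\<close> stands above the rows
  \<open>L 0\<close>, ..., \<open>L (n - 1)\<close> and \<open>g\<close> below them.\<close>

definition bordered_det ::
  "nat \<Rightarrow> (nat \<Rightarrow> nat \<Rightarrow> 'a) \<Rightarrow> (nat \<Rightarrow> 'a) \<Rightarrow> (nat \<Rightarrow> 'a) \<Rightarrow> 'a :: comm_ring_1" where
  "bordered_det n L f g = row_det (Suc (Suc n)) (case_nat f (L(n := g)))"

text \<open>Cramer's rule expresses \<open>row_det n F \<cdot> c\<close> through the rows of \<open>F\<close>, of which only the first
  and the last survive in a determinant that contains the middle ones.\<close>

lemma bordered_det_pluecker:
  "bordered_det n L a b * bordered_det n L c d
    = bordered_det n L c b * bordered_det n L a d + bordered_det n L a c * bordered_det n L b d"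
proof -
  let ?G = "bordered_det n L"
  let ?n = "Suc (Suc n)"
  define F where "F = case_nat a (L(n := b))"
  define H where "H = case_nat a (L(n := d))"
  have upd0: "(case_nat f h)(0 := g) = case_nat g h" for f g and h :: "nat \<Rightarrow> nat \<Rightarrow> 'a"
    by (rule ext) (auto split: nat.split)
  have updn: "(case_nat f (L(n := g)))(Suc n := h) = case_nat f (L(n := h))" for f g h
    by (rule ext) (auto split: nat.split)
  define cf where "cf = cofactor (mat ?n ?n (\<lambda>(i, j). H i j)) 0"
  \<comment> \<open>The cofactors \<open>cf\<close> do not depend on \<open>f\<close>, so Cramer's
    rule for \<open>c\<close> can be inserted under this sum.\<close>
  have G: "?G f d = (\<Sum>k<?n. f k * cf k)" for f
    using row_det_expand_row[of 0 ?n H f]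
    by (simp add: H_def bordered_det_def upd0 cf_def del: sum.lessThan_Suc)
  have "?G a b * ?G c d = (\<Sum>k<?n. (row_det ?n F * c k) * cf k)"
    by (subst G) (simp add: bordered_det_def F_def sum_distrib_left mult.assoc del: sum.lessThan_Suc)
  also have "\<dots> = (\<Sum>k<?n. (\<Sum>i<?n. row_det ?n (F(i := c)) * F i k) * cf k)"
    by (rule sum.cong) (simp_all add: row_det_cramer del: sum.lessThan_Suc)
  also have "\<dots> = (\<Sum>i<?n. row_det ?n (F(i := c)) * ?G (F i) d)"
    unfolding G sum_distrib_right sum_distrib_left
    by (subst sum.swap) (simp add: mult.assoc del: sum.lessThan_Suc)
  also have "\<dots> = row_det ?n (F(0 := c)) * ?G (F 0) d
      + (\<Sum>i<n. row_det ?n (F(Suc i := c)) * ?G (F (Suc i)) d)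
      + row_det ?n (F(Suc n := c)) * ?G (F (Suc n)) d"
    by (subst sum.lessThan_Suc) (subst sum.lessThan_Suc_shift, simp)
  also have "(\<Sum>i<n. row_det ?n (F(Suc i := c)) * ?G (F (Suc i)) d) = 0"
  proof (rule sum.neutral, rule ballI)
    fix i assume "i \<in> {..<n}"
    then have "?G (F (Suc i)) d = 0"
      unfolding bordered_det_def F_def by (intro row_det_identical_rows[of 0 "Suc i"]) auto
    then show "row_det ?n (F(Suc i := c)) * ?G (F (Suc i)) d = 0" by simp
  qed
  finally show ?thesis
    by (simp add: F_def bordered_det_def upd0 updn)
qed

section \<open>Removing evaluation rows by column operations\<close>

text \<open>The sign is that of moving one row past \<open>n\<close> others.\<close>

lemma row_det_first_to_last:
  "row_det (Suc n) (case_nat f F) = (- 1) ^ n * row_det (Suc n) (F(n := f))"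
proof -
  let ?M = "mat (Suc n) (Suc n) (\<lambda>(i, j). (F(n := f)) i j)"
  have "swap_row_to_front ?M n = mat (Suc n) (Suc n) (\<lambda>(i, j). case_nat f F i j)"
    by (subst swap_row_to_front_result[of _ "Suc n" "Suc n"])
      (auto intro!: eq_matI split: nat.split)
  then show ?thesis
    using swap_row_to_front_det[of ?M "Suc n" n] by (simp add: row_det_def)
qed

lemma row_det_mult:
  fixes F T :: "nat \<Rightarrow> nat \<Rightarrow> 'a :: comm_ring_1"
  shows "row_det n F * row_det n T = row_det n (\<lambda>i k. \<Sum>j<n. F i j * T j k)"
proof -
  have "mat n n (\<lambda>(i, j). F i j) * mat n n (\<lambda>(i, j). T i j)
      = mat n n (\<lambda>(i, k). \<Sum>j<n. F i j * T j k)"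
    by (rule eq_matI) (auto simp: scalar_prod_def lessThan_atLeast0)
  then show ?thesis
    unfolding row_det_def by (subst det_mult[symmetric, of _ n]) auto
qed

lemma row_det_unit_last:
  "row_det (Suc n) (F(n := (\<lambda>k. if k = n then 1 else 0))) = row_det n F"
proof -
  let ?M = "mat (Suc n) (Suc n) (\<lambda>(i, j). (F(n := (\<lambda>k. if k = n then 1 else 0))) i j)"
  have "row_det (Suc n) (F(n := (\<lambda>k. if k = n then 1 else 0)))
      = (\<Sum>k<Suc n. ?M $$ (n, k) * cofactor ?M n k)"
    unfolding row_det_def by (rule laplace_expansion_row) auto
  also have "\<dots> = cofactor ?M n n" by simp
  also have "mat_delete ?M n n = mat n n (\<lambda>(i, j). F i j)"
    unfolding mat_delete_def by (intro eq_matI) auto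
  then have "cofactor ?M n n = row_det n F"
    by (simp add: cofactor_def row_det_def)
  finally show ?thesis .
qed

lemma row_det_unit_first:
  "row_det (Suc n) (case_nat (\<lambda>k. if k = 0 then 1 else 0) F) = row_det n (\<lambda>i k. F i (Suc k))"
proof -
  let ?M = "mat (Suc n) (Suc n) (\<lambda>(i, j). case_nat (\<lambda>k. if k = 0 then 1 else 0) F i j :: 'a)"
  have "row_det (Suc n) (case_nat (\<lambda>k. if k = 0 then 1 else 0) F)
      = (\<Sum>k<Suc n. ?M $$ (0, k) * cofactor ?M 0 k)"
    unfolding row_det_def by (rule laplace_expansion_row) auto
  also have "\<dots> = cofactor ?M 0 0"
    by (subst sum.lessThan_Suc_shift) simp
  also have "mat_delete ?M 0 0 = mat n n (\<lambda>(i, j). F i (Suc j))"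
    unfolding mat_delete_def by (intro eq_matI) auto
  then have "cofactor ?M 0 0 = row_det n (\<lambda>i k. F i (Suc k))"
    by (simp add: cofactor_def row_det_def)
  finally show ?thesis .
qed

text \<open>Subtracting \<open>u\<close> times the preceding column from each later column turns the
  row of powers into a unit vector. This is the passage to the polynomials
  \<open>x^(k+1) - u * x^k\<close>, which vanish at \<open>u\<close>.\<close>

lemma row_det_eval_first:
  fixes F :: "nat \<Rightarrow> nat \<Rightarrow> 'a :: comm_ring_1"
  shows "row_det (Suc n) (case_nat (\<lambda>k. u ^ k) F) = row_det n (\<lambda>i k. F i (Suc k) - u * F i k)"
proof -
  define T :: "nat \<Rightarrow> nat \<Rightarrow> 'a" where
    "T = (\<lambda>j k. if j = k then 1 else if k = Suc j then - u else 0)"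
  have "det (mat (Suc n) (Suc n) (\<lambda>(i, j). T i j)) = 1"
    by (subst det_upper_triangular[of _ "Suc n"])
      (auto simp: T_def upper_triangular_def prod_list_diag_prod)
  then have "row_det (Suc n) (case_nat (\<lambda>k. u ^ k) F)
      = row_det (Suc n) (case_nat (\<lambda>k. u ^ k) F) * row_det (Suc n) T"
    by (simp add: row_det_def)
  also have "\<dots> = row_det (Suc n) (case_nat (\<lambda>k. if k = 0 then 1 else 0)
      (\<lambda>i k. if k = 0 then F i 0 else F i k - u * F i (k - 1)))"
    unfolding row_det_mult
  proof (rule row_det_cong)
    fix i k assume ik: "i < Suc n" "k < Suc n"
    have sum: "(\<Sum>j<Suc n. h j * T j k) = (if k = 0 then h 0 else h k - u * h (k - 1))"
      for h :: "nat \<Rightarrow> 'a"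
    proof -
      have "(\<Sum>j<Suc n. h j * T j k)
          = (\<Sum>j<Suc n. (if j = k then h j else 0) + (if k \<noteq> 0 \<and> j = k - 1 then - u * h j else 0))"
        by (rule sum.cong) (auto simp: T_def)
      also have "\<dots> = (if k = 0 then h 0 else h k - u * h (k - 1))"
        using ik by (cases k) (auto simp: sum.distrib simp del: sum.lessThan_Suc)
      finally show ?thesis .
    qed
    show "(\<Sum>j<Suc n. case_nat (\<lambda>k. u ^ k) F i j * T j k)
        = case_nat (\<lambda>k. if k = 0 then 1 else 0)
            (\<lambda>i k. if k = 0 then F i 0 else F i k - u * F i (k - 1)) i k"
      unfolding sum by (cases i; cases k) auto
  qed
  also have "\<dots> = row_det n (\<lambda>i k. F i (Suc k) - u * F i k)"
    by (simp add: row_det_unit_first)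
  finally show ?thesis .
qed

text \<open>The last row is the evaluation at \<open>1 / c\<close> scaled by \<open>c ^ n\<close>, so that \<open>c = 0\<close> gives the
  leading coefficient, that is, the evaluation at infinity.\<close>

lemma row_det_eval_last:
  fixes F :: "nat \<Rightarrow> nat \<Rightarrow> 'a :: comm_ring_1"
  shows "row_det (Suc n) (F(n := (\<lambda>k. c ^ (n - k)))) = row_det n (\<lambda>i k. F i k - c * F i (Suc k))"
proof -
  let ?e = "\<lambda>k. c ^ (n - k)"
  \<comment> \<open>The mirror image of the previous column operation: \<open>c\<close> times the
    next column is subtracted, and the last column stays.\<close>
  define T :: "nat \<Rightarrow> nat \<Rightarrow> 'a" where
    "T = (\<lambda>j k. if j = k then 1 else if j = Suc k then - c else 0)"
  have "det (mat (Suc n) (Suc n) (\<lambda>(i, j). T i j)) = 1"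
    by (subst det_lower_triangular[of "Suc n"]) (auto simp: T_def prod_list_diag_prod)
  then have "row_det (Suc n) (F(n := ?e)) = row_det (Suc n) (F(n := ?e)) * row_det (Suc n) T"
    by (simp add: row_det_def)
  also have "\<dots> = row_det (Suc n)
      ((\<lambda>i k. if k = n then F i n else F i k - c * F i (Suc k))(n := (\<lambda>k. if k = n then 1 else 0)))"
    unfolding row_det_mult
  proof (rule row_det_cong)
    fix i k assume ik: "i < Suc n" "k < Suc n"
    have sum: "(\<Sum>j<Suc n. h j * T j k) = (if k = n then h n else h k - c * h (Suc k))"
      for h :: "nat \<Rightarrow> 'a"
    proof -
      have "(\<Sum>j<Suc n. h j * T j k)
          = (\<Sum>j<Suc n. (if j = k then h j else 0) + (if j = Suc k then - c * h j else 0))"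
        by (rule sum.cong) (auto simp: T_def)
      also have "\<dots> = (if k = n then h n else h k - c * h (Suc k))"
        using ik by (auto simp: sum.distrib simp del: sum.lessThan_Suc)
      finally show ?thesis .
    qed
    show "(\<Sum>j<Suc n. (F(n := ?e)) i j * T j k)
        = ((\<lambda>i k. if k = n then F i n else F i k - c * F i (Suc k))
            (n := (\<lambda>k. if k = n then 1 else 0))) i k"
      unfolding sum using ik by (auto simp: Suc_diff_Suc simp flip: power_Suc)
  qed
  also have "\<dots> = row_det n (\<lambda>i k. F i k - c * F i (Suc k))"
    by (subst row_det_unit_last) (auto intro: row_det_cong)
  finally show ?thesis .
qed

section \<open>Bordered determinants whose borders are evaluations\<close>

lemma bordered_det_eval_first:
  "bordered_det n L (\<lambda>k. u ^ k) g
    = row_det (Suc n) ((\<lambda>i k. L i (Suc k) - u * L i k)(n := (\<lambda>k. g (Suc k) - u * g k)))"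
  unfolding bordered_det_def row_det_eval_first by (rule row_det_cong) simp

text \<open>Removing the first border changes the second by the factor \<open>1 - u * c\<close>, the
  Vandermonde factor of the points \<open>u\<close> and \<open>1 / c\<close>, rescaled by
  \<open>c\<close>.\<close>

lemma bordered_det_eval_first_last:
  "bordered_det n L (\<lambda>k. u ^ k) (\<lambda>k. c ^ (Suc n - k)) = (1 - u * c) *
    row_det n (\<lambda>i k. L i (Suc k) - u * L i k - c * (L i (Suc (Suc k)) - u * L i (Suc k)))"
proof -
  let ?L = "\<lambda>i k. L i (Suc k) - u * L i k"
  have "bordered_det n L (\<lambda>k. u ^ k) (\<lambda>k. c ^ (Suc n - k))
      = row_det (Suc n) (?L(n := (\<lambda>k. (1 - u * c) * c ^ (n - k))))"
    unfolding bordered_det_eval_first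
    by (rule row_det_cong) (auto simp: Suc_diff_le algebra_simps)
  then show ?thesis
    by (simp add: row_det_scale_row row_det_eval_last)
qed

lemma bordered_det_eval_first_infinity_last:
  "bordered_det n L (\<lambda>k. u ^ k) (\<lambda>k. 0 ^ (Suc n - k))
    = row_det n (\<lambda>i k. L i (Suc k) - u * L i k)"
  unfolding bordered_det_eval_first_last by simp

text \<open>Since \<open>0 ^ 0 = 1\<close>, the first border is the evaluation at \<open>0\<close>.
  Its removal leaves \<open>u * u ^ k\<close> in the other border, whence the factor
  \<open>u\<close>; the sign comes from moving that border to the front.\<close>

lemma bordered_det_eval_first_first:
  "bordered_det n L (\<lambda>k. 0 ^ k) (\<lambda>k. u ^ k) =
    (- 1) ^ n * u * row_det n (\<lambda>i k. L i (Suc (Suc k)) - u * L i (Suc k))"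
proof -
  let ?L = "\<lambda>i k. L i (Suc k)"
  have "bordered_det n L (\<lambda>k. 0 ^ k) (\<lambda>k. u ^ k) = u * row_det (Suc n) (?L(n := (\<lambda>k. u ^ k)))"
    by (simp add: bordered_det_eval_first row_det_scale_row)
  also have "row_det (Suc n) (?L(n := (\<lambda>k. u ^ k)))
      = (- 1) ^ n * row_det (Suc n) (case_nat (\<lambda>k. u ^ k) ?L)"
    by (simp add: row_det_first_to_last flip: mult.assoc power_mult_distrib)
  finally show ?thesis by (simp add: row_det_eval_first ac_simps)
qed

text \<open>The evaluation at infinity is moved past \<open>n + 1\<close> rows and then removed as
  the case \<open>c = 0\<close> of an evaluation in the last row.\<close>

lemma bordered_det_infinity_first:
  "bordered_det n L (\<lambda>k. 0 ^ (Suc n - k)) g = (- 1) ^ Suc n * row_det (Suc n) (L(n := g))"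
  unfolding bordered_det_def row_det_first_to_last row_det_eval_last by (simp add: fun_upd_def)

section \<open>The bilinear identities for general rows\<close>

text \<open>Pluecker relation for the points \<open>0\<close>, infinity, \<open>- b\<close> and
  \<open>1 / c\<close>; the factors \<open>1 + c * b\<close> and \<open>c * b\<close> come from the
  borders.\<close>

lemma row_det_bilinear_shift:
  "(1 + c * b) * row_det n (\<lambda>i k. L i (Suc k)) *
      row_det n (\<lambda>i k. L i (Suc k) + b * L i k - c * (L i (Suc (Suc k)) + b * L i (Suc k)))
    = row_det n (\<lambda>i k. L i (Suc k) + b * L i k) *
        row_det n (\<lambda>i k. L i (Suc k) - c * L i (Suc (Suc k)))
      + c * b * row_det n (\<lambda>i k. L i (Suc (Suc k)) + b * L i (Suc k)) *
        row_det n (\<lambda>i k. L i k - c * L i (Suc k))"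
proof -
  have inf_first: "bordered_det n L (\<lambda>k. 0 ^ (Suc n - k)) (\<lambda>k. c ^ (Suc n - k))
      = (- 1) ^ Suc n * (c * row_det n (\<lambda>i k. L i k - c * L i (Suc k)))"
  proof -
    \<comment> \<open>Only columns \<open>k \<le> n\<close> remain, so the border of exponent
      \<open>Suc n - k\<close> has a factor \<open>c\<close> to split off.\<close>
    have "row_det (Suc n) (L(n := (\<lambda>k. c ^ (Suc n - k))))
        = row_det (Suc n) (L(n := (\<lambda>k. c * c ^ (n - k))))"
      by (rule row_det_cong) (auto simp: Suc_diff_le)
    then show ?thesis
      by (simp add: bordered_det_infinity_first row_det_scale_row row_det_eval_last)
  qed
  have sgn: "(- 1) ^ n * (x * ((- 1) ^ n * y)) = x * y" for x y :: 'a
    by (cases "even n") auto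
  show ?thesis
    using bordered_det_pluecker[of n L "\<lambda>k. 0 ^ k" "\<lambda>k. 0 ^ (Suc n - k)"
      "\<lambda>k. (- b) ^ k" "\<lambda>k. c ^ (Suc n - k)"]
    unfolding inf_first bordered_det_eval_first_infinity_last bordered_det_eval_first_first
      bordered_det_eval_first_last
    by (simp add: sgn ac_simps)
qed

text \<open>With \<open>L n\<close> as the last border, \<open>L(n := L n)\<close> is
  \<open>L\<close> itself, and removing the other border leaves a determinant of order
  \<open>n + 1\<close>.\<close>

lemma row_det_bilinear_size:
  "row_det n (\<lambda>i k. L i (Suc k)) * row_det (Suc n) (\<lambda>i k. L i (Suc k) + b * L i k)
    = row_det n (\<lambda>i k. L i (Suc k) + b * L i k) * row_det (Suc n) (\<lambda>i k. L i (Suc k))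
      + b * row_det n (\<lambda>i k. L i (Suc (Suc k)) + b * L i (Suc k)) * row_det (Suc n) L"
proof -
  have row_last: "bordered_det n L (\<lambda>k. u ^ k) (L n)
      = row_det (Suc n) (\<lambda>i k. L i (Suc k) - u * L i k)" for u
    by (simp add: bordered_det_def row_det_eval_first)
  have sgn: "(- 1) ^ n * (x * ((- 1) ^ n * y)) = x * y" for x y :: 'a
    by (cases "even n") auto
  show ?thesis
    using bordered_det_pluecker[of n L "\<lambda>k. 0 ^ k" "\<lambda>k. 0 ^ (Suc n - k)" "\<lambda>k. (- b) ^ k" "L n"]
    unfolding row_last bordered_det_eval_first_infinity_last bordered_det_eval_first_first
      bordered_det_infinity_first
    by (simp add: sgn ac_simps)
qed

section \<open>The prefactor of \<open>tau\<close>\<close>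

definition gauge :: "complex \<Rightarrow> complex \<Rightarrow> complex \<Rightarrow> int \<Rightarrow> int \<Rightarrow> complex" where
  "gauge b x y m s = x powi (- m) * y powi (- s) * b powi (- (m * s))"

lemma gauge_Suc_m:
  assumes "b \<noteq> 0" "x \<noteq> 0"
  shows "gauge b x y (m + 1) s * (x * b powi s) = gauge b x y m s"
proof -
  have "x powi (- (m + 1)) * x = x powi (- m)"
    using power_int_add[of x "- (m + 1)" 1] assms by simp
  moreover have "b powi (- ((m + 1) * s)) * b powi s = b powi (- (m * s))"
    using assms by (simp add: algebra_simps flip: power_int_add)
  ultimately show ?thesis
    unfolding gauge_def by (metis mult.commute mult.left_commute)
qed

lemma gauge_Suc_s:
  assumes "b \<noteq> 0" "y \<noteq> 0"
  shows "gauge b x y m (s + 1) * (y * b powi m) = gauge b x y m s"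
  \<comment> \<open>\<open>gauge\<close> is symmetric under exchanging \<open>(x, m)\<close> with
    \<open>(y, s)\<close>.\<close>
  using gauge_Suc_m[of b y x s m] assms by (simp add: gauge_def ac_simps)

lemma tau_eq_gauge:
  "tau P2 Q2 P3 Q3 b \<phi> l1 l2 l3 m s
    = gauge b (P2 l2 * P3 l3) (Q2 l2 * Q3 l3) m s * casorati \<phi> l1 l2 l3 m s"
  by (simp add: tau_def gauge_def power_int_mult_distrib ac_simps)

lemma gauge_bilinear:
  assumes "b \<noteq> 0" "x \<noteq> 0" "y \<noteq> 0" "\<alpha> \<noteq> 0" "c \<noteq> 0"
    and bil: "\<alpha> * A * A' = B * B' + c * b * C * C'"
  shows "(gauge b x y (m + 1) s * A) * (gauge b (\<alpha> * x) (c * y) m s * A')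
      - (gauge b x y m s * B) * (gauge b (\<alpha> * x) (c * y) (m + 1) s * B')
    = (gauge b x y m (s + 1) * C) * (gauge b (\<alpha> * x) (c * y) (m + 1) (s - 1) * C')"
proof -
  let ?w = "gauge b x y" and ?w' = "gauge b (\<alpha> * x) (c * y)"
  have w_m: "?w (m + 1) s * (x * b powi s) = ?w m s"
    and w'_m: "?w' (m + 1) s * (\<alpha> * x * b powi s) = ?w' m s"
    using assms by (simp_all add: gauge_Suc_m)
  have w_s: "?w m (s + 1) * (y * b powi m) = ?w m s"
    using assms by (simp add: gauge_Suc_s)
  have w'_s: "?w' (m + 1) s * (c * y * (b powi m * b)) = ?w' (m + 1) (s - 1)"
    using assms gauge_Suc_s[of b "c * y" "\<alpha> * x" "m + 1" "s - 1"] by (simp add: power_int_add)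
  have 1: "?w (m + 1) s * ?w' m s = \<alpha> * (?w m s * ?w' (m + 1) s)"
    unfolding w_m[symmetric] w'_m[symmetric] by simp
  have 2: "?w m (s + 1) * ?w' (m + 1) (s - 1) = c * b * (?w m s * ?w' (m + 1) s)"
    unfolding w_s[symmetric] w'_s[symmetric] by simp
  have "(?w (m + 1) s * A) * (?w' m s * A') - (?w m s * B) * (?w' (m + 1) s * B')
      = (?w (m + 1) s * ?w' m s) * (A * A') - (?w m s * ?w' (m + 1) s) * (B * B')"
    by (simp add: ac_simps)
  also have "\<dots> = (?w m s * ?w' (m + 1) s) * (\<alpha> * A * A' - B * B')"
    unfolding 1 by (simp add: algebra_simps)
  also have "\<dots> = (?w m (s + 1) * ?w' (m + 1) (s - 1)) * (C * C')"
    unfolding bil 2 by simp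
  finally show ?thesis by (simp add: ac_simps)
qed

section \<open>Bilinear equations for the Casorati determinants and for \<open>tau\<close>\<close>

lemma casorati_eq_row_det:
  "casorati \<phi> n l2 l3 m s = row_det n (\<lambda>i k. \<phi> (Suc i) l2 l3 m (s + int k))"
  by (simp add: casorati_def row_det_def)

lemma casorati_bilinear_size:
  assumes "\<And>i m s. i \<ge> 1 \<Longrightarrow> \<phi> i l2 l3 m s = \<phi> i l2 l3 (m + 1) s + b * \<phi> i l2 l3 (m + 1) (s - 1)"
  shows "casorati \<phi> n l2 l3 (m + 1) s * casorati \<phi> (n + 1) l2 l3 m s
    = casorati \<phi> n l2 l3 m s * casorati \<phi> (n + 1) l2 l3 (m + 1) s
      + b * casorati \<phi> n l2 l3 m (s + 1) * casorati \<phi> (n + 1) l2 l3 (m + 1) (s - 1)"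
  using row_det_bilinear_size[of n "\<lambda>i k. \<phi> (Suc i) l2 l3 (m + 1) (s - 1 + int k)" b]
  by (simp add: casorati_eq_row_det assms[of _ m] algebra_simps)

lemma casorati_bilinear_shift:
  assumes "\<And>i m s. i \<ge> 1 \<Longrightarrow> \<phi> i l2 l3 m s = \<phi> i l2 l3 (m + 1) s + b * \<phi> i l2 l3 (m + 1) (s - 1)"
    and "\<And>i m s. i \<ge> 1 \<Longrightarrow> \<phi> i l2' l3 m s = \<phi> i l2 l3 m s - c * \<phi> i l2 l3 m (s + 1)"
  shows "(1 + c * b) * casorati \<phi> n l2 l3 (m + 1) s * casorati \<phi> n l2' l3 m s
    = casorati \<phi> n l2 l3 m s * casorati \<phi> n l2' l3 (m + 1) s
      + c * b * casorati \<phi> n l2 l3 m (s + 1) * casorati \<phi> n l2' l3 (m + 1) (s - 1)"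
  using row_det_bilinear_shift[of c b n "\<lambda>i k. \<phi> (Suc i) l2 l3 (m + 1) (s - 1 + int k)"]
  by (simp add: casorati_eq_row_det assms(2) assms(1)[of _ m] algebra_simps)

lemma tau_bilinear_l2:
  assumes "b \<noteq> 0" "c l2 \<noteq> 0" "1 + c l2 * b \<noteq> 0" "P3 l3 \<noteq> 0" "Q3 l3 \<noteq> 0"
    and P: "indefinite_product (\<lambda>j. 1 + c j * b) P" and Q: "indefinite_product c Q"
    and rel_l: "\<And>i m s. i \<ge> 1 \<Longrightarrow>
      (\<phi> i (l2 + 1) l3 m s - \<phi> i l2 l3 m s) / c l2 = - \<phi> i l2 l3 m (s + 1)"
    and rel_m: "\<And>i m s. i \<ge> 1 \<Longrightarrow>
      (\<phi> i l2 l3 m s - \<phi> i l2 l3 (m - 1) s) / b = - \<phi> i l2 l3 m (s - 1)"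
  defines "\<tau> \<equiv> tau P Q P3 Q3 b \<phi>"
  shows "\<tau> n l2 l3 (m + 1) s * \<tau> n (l2 + 1) l3 m s - \<tau> n l2 l3 m s * \<tau> n (l2 + 1) l3 (m + 1) s
    = \<tau> n l2 l3 m (s + 1) * \<tau> n (l2 + 1) l3 (m + 1) (s - 1)"
proof -
  have nz: "P l2 \<noteq> 0" "Q l2 \<noteq> 0"
    and step: "P (l2 + 1) = (1 + c l2 * b) * P l2" "Q (l2 + 1) = c l2 * Q l2"
    using P Q by (auto simp: indefinite_product_def)
  have "\<phi> i l2 l3 m s = \<phi> i l2 l3 (m + 1) s + b * \<phi> i l2 l3 (m + 1) (s - 1)" if "i \<ge> 1" for i m s
    \<comment> \<open>The relation taken at \<open>m + 1\<close> expresses level \<open>m\<close>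
      through level \<open>m + 1\<close>, where the rows \<open>L\<close> live.\<close>
    using rel_m[OF that, of "m + 1" s] \<open>b \<noteq> 0\<close> by (simp add: field_simps)
  moreover have "\<phi> i (l2 + 1) l3 m s = \<phi> i l2 l3 m s - c l2 * \<phi> i l2 l3 m (s + 1)" if "i \<ge> 1" for i m s
    using rel_l[OF that, of m s] \<open>c l2 \<noteq> 0\<close> by (simp add: field_simps)
  ultimately have "(1 + c l2 * b) * casorati \<phi> n l2 l3 (m + 1) s * casorati \<phi> n (l2 + 1) l3 m s
    = casorati \<phi> n l2 l3 m s * casorati \<phi> n (l2 + 1) l3 (m + 1) s
      + c l2 * b * casorati \<phi> n l2 l3 m (s + 1) * casorati \<phi> n (l2 + 1) l3 (m + 1) (s - 1)"
    by (rule casorati_bilinear_shift)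
  then show ?thesis
    \<comment> \<open>Reassociating exhibits the shifted arguments of \<open>gauge\<close> as
      \<open>\<alpha> * x\<close> and \<open>c * y\<close>, with \<open>x = P l2 * P3 l3\<close> and
      \<open>y = Q l2 * Q3 l3\<close>.\<close>
    unfolding \<tau>_def tau_eq_gauge step mult.assoc[of _ "P l2"] mult.assoc[of _ "Q l2"]
    using assms(1-5) nz by (intro gauge_bilinear) auto
qed

lemma tau_bilinear_l1:
  assumes "b \<noteq> 0" "P2 l2 \<noteq> 0" "Q2 l2 \<noteq> 0" "P3 l3 \<noteq> 0" "Q3 l3 \<noteq> 0"
    and rel_m: "\<And>i m s. i \<ge> 1 \<Longrightarrow>
      (\<phi> i l2 l3 m s - \<phi> i l2 l3 (m - 1) s) / b = - \<phi> i l2 l3 m (s - 1)"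
  defines "\<tau> \<equiv> tau P2 Q2 P3 Q3 b \<phi>"
  shows "\<tau> n l2 l3 (m + 1) s * \<tau> (n + 1) l2 l3 m s - \<tau> n l2 l3 m s * \<tau> (n + 1) l2 l3 (m + 1) s
    = \<tau> n l2 l3 m (s + 1) * \<tau> (n + 1) l2 l3 (m + 1) (s - 1)"
proof -
  have "\<phi> i l2 l3 m s = \<phi> i l2 l3 (m + 1) s + b * \<phi> i l2 l3 (m + 1) (s - 1)" if "i \<ge> 1" for i m s
    using rel_m[OF that, of "m + 1" s] \<open>b \<noteq> 0\<close> by (simp add: field_simps)
  then have "casorati \<phi> n l2 l3 (m + 1) s * casorati \<phi> (n + 1) l2 l3 m s
    = casorati \<phi> n l2 l3 m s * casorati \<phi> (n + 1) l2 l3 (m + 1) s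
      + b * casorati \<phi> n l2 l3 m (s + 1) * casorati \<phi> (n + 1) l2 l3 (m + 1) (s - 1)"
    by (rule casorati_bilinear_size)
  then show ?thesis
    unfolding \<tau>_def tau_eq_gauge
    using assms(1-5) gauge_bilinear[where \<alpha> = 1 and c = 1] by simp
qed

text \<open>The variables \<open>l2\<close> and \<open>l3\<close> enter symmetrically, so the
  equation for \<open>l3\<close> follows from the one for \<open>l2\<close>.\<close>

lemma tau_swap:
  "tau P2 Q2 P3 Q3 b \<phi> n l2 l3 m s = tau P3 Q3 P2 Q2 b (\<lambda>i l3 l2. \<phi> i l2 l3) n l3 l2 m s"
  by (simp add: tau_def casorati_def ac_simps)

theorem theorem2p4:
  fixes c2 c3 P2 P3 Q2 Q3 :: "int \<Rightarrow> complex"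
    and b :: complex
    and \<phi> :: "nat \<Rightarrow> int \<Rightarrow> int \<Rightarrow> int \<Rightarrow> int \<Rightarrow> complex"
    and \<tau> :: "nat \<Rightarrow> int \<Rightarrow> int \<Rightarrow> int \<Rightarrow> int \<Rightarrow> complex"
  assumes b_nz: "b \<noteq> 0"
    and c2_nz: "\<And>l. c2 l \<noteq> 0" and c3_nz: "\<And>l. c3 l \<noteq> 0"
    and c2b_nz: "\<And>l. 1 + c2 l * b \<noteq> 0" and c3b_nz: "\<And>l. 1 + c3 l * b \<noteq> 0"
    and P2: "indefinite_product (\<lambda>j. 1 + c2 j * b) P2"
    and P3: "indefinite_product (\<lambda>j. 1 + c3 j * b) P3"
    and Q2: "indefinite_product c2 Q2"
    and Q3: "indefinite_product c3 Q3"
    and rel_l2: "\<And>i l2 l3 m s. i \<ge> 1 \<Longrightarrow>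
      (\<phi> i (l2 + 1) l3 m s - \<phi> i l2 l3 m s) / c2 l2 = - \<phi> i l2 l3 m (s + 1)"
    and rel_l3: "\<And>i l2 l3 m s. i \<ge> 1 \<Longrightarrow>
      (\<phi> i l2 (l3 + 1) m s - \<phi> i l2 l3 m s) / c3 l3 = - \<phi> i l2 l3 m (s + 1)"
    and rel_m: "\<And>i l2 l3 m s. i \<ge> 1 \<Longrightarrow>
      (\<phi> i l2 l3 m s - \<phi> i l2 l3 (m - 1) s) / b = - \<phi> i l2 l3 m (s - 1)"
  defines "\<tau> \<equiv> tau P2 Q2 P3 Q3 b \<phi>"
  shows
    "\<forall>l1 l2 l3 m s.
       \<tau> l1 l2 l3 (m + 1) s * \<tau> (l1 + 1) l2 l3 m s - \<tau> l1 l2 l3 m s * \<tau> (l1 + 1) l2 l3 (m + 1) s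
         = \<tau> l1 l2 l3 m (s + 1) * \<tau> (l1 + 1) l2 l3 (m + 1) (s - 1)
     \<and> \<tau> l1 l2 l3 (m + 1) s * \<tau> l1 (l2 + 1) l3 m s - \<tau> l1 l2 l3 m s * \<tau> l1 (l2 + 1) l3 (m + 1) s
         = \<tau> l1 l2 l3 m (s + 1) * \<tau> l1 (l2 + 1) l3 (m + 1) (s - 1)
     \<and> \<tau> l1 l2 l3 (m + 1) s * \<tau> l1 l2 (l3 + 1) m s - \<tau> l1 l2 l3 m s * \<tau> l1 l2 (l3 + 1) (m + 1) s
         = \<tau> l1 l2 l3 m (s + 1) * \<tau> l1 l2 (l3 + 1) (m + 1) (s - 1)"
proof (intro allI conjI)
  fix l1 :: nat and l2 l3 m s :: int
  have nz: "P2 l \<noteq> 0" "P3 l \<noteq> 0" "Q2 l \<noteq> 0" "Q3 l \<noteq> 0" for l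
    using P2 P3 Q2 Q3 by (auto simp: indefinite_product_def)
  show "\<tau> l1 l2 l3 (m + 1) s * \<tau> (l1 + 1) l2 l3 m s - \<tau> l1 l2 l3 m s * \<tau> (l1 + 1) l2 l3 (m + 1) s
      = \<tau> l1 l2 l3 m (s + 1) * \<tau> (l1 + 1) l2 l3 (m + 1) (s - 1)"
    unfolding \<tau>_def by (rule tau_bilinear_l1) (use b_nz nz rel_m in auto)
  show "\<tau> l1 l2 l3 (m + 1) s * \<tau> l1 (l2 + 1) l3 m s - \<tau> l1 l2 l3 m s * \<tau> l1 (l2 + 1) l3 (m + 1) s
      = \<tau> l1 l2 l3 m (s + 1) * \<tau> l1 (l2 + 1) l3 (m + 1) (s - 1)"
    unfolding \<tau>_def
    by (rule tau_bilinear_l2[where c = c2]) (use b_nz c2_nz c2b_nz nz P2 Q2 rel_l2 rel_m in auto)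
  show "\<tau> l1 l2 l3 (m + 1) s * \<tau> l1 l2 (l3 + 1) m s - \<tau> l1 l2 l3 m s * \<tau> l1 l2 (l3 + 1) (m + 1) s
      = \<tau> l1 l2 l3 m (s + 1) * \<tau> l1 l2 (l3 + 1) (m + 1) (s - 1)"
    unfolding \<tau>_def tau_swap[of P2]
    by (rule tau_bilinear_l2[where c = c3]) (use b_nz c3_nz c3b_nz nz P3 Q3 rel_l3 rel_m in auto)
qed

end
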